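(* Let $d \geq 1$ be an integer and let $\delta > 0$. Then the noisy voter model with noise parameter $\delta$ has strong spatial mixing on $\mathbb{Z}^d$; that is, there exist constants $C, c > 0$ (which may depend on $\delta$ and $d$) such that for every finite box $G \subseteq \mathbb{Z}^d$, every nonempty box $H \subseteq G$, every site $u \in \partial G$, and every pair of boundary conditions $\tau, \tau^u \in \{0,1\}^{\partial G}$ that differ only at $u$, \[ \left\| \mu_{G}^{\tau}|_H - \mu_{G}^{\tau^u}|_H \right\| \leq C\,|V(H)|\,\exp\left(-c\cdot \mathrm{dist}(u,H)\right). \]
   Context: Consider the integer lattice $\mathbb{Z}^d$ as a graph with nearest-neighbour edges ($x\sim y$ iff $\sum_{i=1}^d |x_i-y_i| = 1$), so every vertex has degree $2d$. A (finite) box in $\mathbb{Z}^d$ is a finite induced subgraph of $\mathbb{Z}^d$, i.e. an arbitrary finite set of vertices together with all lattice edges between them (it need not be cuboidal); $V(G)$ denotes its vertex set, and $H\subseteq G$ means $V(H)\subseteq V(G)$. The boundary $\partial G$ is the set of vertices of $\mathbb{Z}^d$ not in $G$ that have at least one neighbour in $G$. For $u,v\in\mathbb{Z}^d$, $\mathrm{dist}(u,v)=\sum_{i=1}^d|u_i-v_i|$, and for a box $H$, $\mathrm{dist}(u,H)=\min_{v\in V(H)}\mathrm{dist}(u,v)$. Noisy voter model with boundary condition: given $\delta>0$, a finite box $G$ and a boundary condition $\tau\in\{0,1\}^{\partial G}$, the noisy voter model on $G$ with noise parameter $\delta$ and boundary condition $\tau$ is the noisy voter dynamics run on $G\cup\partial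 G$ with the spins at $\partial G$ frozen at the values $\tau$. Explicitly, it is the continuous-time Markov chain on $\{0,1\}^{V(G)}$ in which, from state $\eta$, the spin at $x\in V(G)$ is flipped (from $\eta(x)$ to $1-\eta(x)$, all other spins unchanged) at rate \[ c(x,\eta)=\frac{1}{2\delta+1}\left[\frac{1}{2d}\#\{y\in \mathbb{Z}^d : y\sim x,\ \eta(y)\neq\eta(x)\}+\delta\right], \] where $\eta(y)$ is read as $\tau(y)$ for $y\in\partial G$ (all neighbours of $x\in V(G)$ lie in $V(G)\cup\partial G$), and no other transitions occur. This chain is irreducible on a finite state space, so it has a unique stationary distribution $\mu_G^\tau$ on $\{0,1\}^{V(G)}$. For a box $H\subseteq G$, $\mu_G^\tau|_H$ denotes the projection (marginal) of $\mu_G^\tau$ onto $\{0,1\}^{V(H)}$. For probability measures $\mu_1,\mu_2$ on a finite set $S$, $\|\mu_1-\mu_2\|=\max_{A\subseteq S}|\mu_1(A)-\mu_2(A)|$ is the total variation distance. *)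

theory Defs
  imports "HOL-Probability.Probability"
begin

(* The lattice Z^d is the type int ^ 'd, with d = CARD('d); a box is an arbitrary finite set of
   vertices, the edges being induced. *)

definition lattice_dist :: "int ^ 'd \<Rightarrow> int ^ 'd \<Rightarrow> int" where
  "lattice_dist u v = (\<Sum>i\<in>UNIV. \<bar>u $ i - v $ i\<bar>)"

definition lattice_adj :: "int ^ 'd \<Rightarrow> int ^ 'd \<Rightarrow> bool" where
  "lattice_adj x y \<longleftrightarrow> lattice_dist x y = 1"

definition box_boundary :: "(int ^ 'd) set \<Rightarrow> (int ^ 'd) set" where
  "box_boundary G = {y. y \<notin> G \<and> (\<exists>x\<in>G. lattice_adj x y)}"

definition box_dist :: "int ^ 'd \<Rightarrow> (int ^ 'd) set \<Rightarrow> int" where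
  "box_dist u H = Min (lattice_dist u ` H)"

(* {0,1}^V, with the spin values 0 and 1 represented by False and True. Configurations are
   extensional, so that they correspond exactly to functions with domain V. *)

definition configs :: "(int ^ 'd) set \<Rightarrow> (int ^ 'd \<Rightarrow> bool) set" where
  "configs V = V \<rightarrow>\<^sub>E UNIV"

definition with_boundary ::
    "(int ^ 'd) set \<Rightarrow> (int ^ 'd \<Rightarrow> bool) \<Rightarrow> (int ^ 'd \<Rightarrow> bool) \<Rightarrow> int ^ 'd \<Rightarrow> bool" where
  "with_boundary G \<tau> \<eta> y = (if y \<in> G then \<eta> y else \<tau> y)"

definition flip_rate ::
    "real \<Rightarrow> (int ^ 'd) set \<Rightarrow> (int ^ 'd \<Rightarrow> bool) \<Rightarrow> int ^ 'd \<Rightarrow> (int ^ 'd \<Rightarrow> bool) \<Rightarrow> real" where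
  "flip_rate \<delta> G \<tau> x \<eta> =
     1 / (2 * \<delta> + 1) *
       (1 / (2 * real CARD('d)) *
          real (card {y. lattice_adj x y \<and> with_boundary G \<tau> \<eta> y \<noteq> with_boundary G \<tau> \<eta> x}) + \<delta>)"

(* The infinitesimal generator L of the chain that flips the spin at each x in G at rate
   flip_rate, and its Markov semigroup exp (t L): for a configuration \<eta> on G,
   noisy_voter_semigroup \<delta> G \<tau> t f \<eta> is the expectation of f at time t for the chain
   started in \<eta>. *)

definition noisy_voter_generator ::
    "real \<Rightarrow> (int ^ 'd) set \<Rightarrow> (int ^ 'd \<Rightarrow> bool) \<Rightarrow>
     ((int ^ 'd \<Rightarrow> bool) \<Rightarrow> real) \<Rightarrow> (int ^ 'd \<Rightarrow> bool) \<Rightarrow> real" where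
  "noisy_voter_generator \<delta> G \<tau> f \<eta> =
     (\<Sum>x\<in>G. flip_rate \<delta> G \<tau> x \<eta> * (f (\<eta>(x := \<not> \<eta> x)) - f \<eta>))"

definition noisy_voter_semigroup ::
    "real \<Rightarrow> (int ^ 'd) set \<Rightarrow> (int ^ 'd \<Rightarrow> bool) \<Rightarrow> real \<Rightarrow>
     ((int ^ 'd \<Rightarrow> bool) \<Rightarrow> real) \<Rightarrow> (int ^ 'd \<Rightarrow> bool) \<Rightarrow> real" where
  "noisy_voter_semigroup \<delta> G \<tau> t f \<eta> =
     (\<Sum>n. t ^ n / fact n * ((noisy_voter_generator \<delta> G \<tau> ^^ n) f) \<eta>)"

definition noisy_voter_stationary ::
    "real \<Rightarrow> (int ^ 'd) set \<Rightarrow> (int ^ 'd \<Rightarrow> bool) \<Rightarrow> (int ^ 'd \<Rightarrow> bool) pmf \<Rightarrow> bool" where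
  "noisy_voter_stationary \<delta> G \<tau> \<mu> \<longleftrightarrow>
     set_pmf \<mu> \<subseteq> configs G \<and>
     (\<forall>t\<ge>0. \<forall>f. measure_pmf.expectation \<mu> (noisy_voter_semigroup \<delta> G \<tau> t f)
                 = measure_pmf.expectation \<mu> f)"

(* Meaningful for \<delta> > 0 and finite G: the chain is then irreducible on a finite state space,
   so exactly one stationary distribution exists. *)

definition noisy_voter_measure ::
    "real \<Rightarrow> (int ^ 'd) set \<Rightarrow> (int ^ 'd \<Rightarrow> bool) \<Rightarrow> (int ^ 'd \<Rightarrow> bool) pmf" where
  "noisy_voter_measure \<delta> G \<tau> = (THE \<mu>. noisy_voter_stationary \<delta> G \<tau> \<mu>)"

definition marginal ::
    "(int ^ 'd) set \<Rightarrow> (int ^ 'd \<Rightarrow> bool) pmf \<Rightarrow> (int ^ 'd \<Rightarrow> bool) pmf" where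
  "marginal H \<mu> = map_pmf (\<lambda>\<eta>. restrict \<eta> H) \<mu>"

definition tv_dist :: "'s set \<Rightarrow> 's pmf \<Rightarrow> 's pmf \<Rightarrow> real" where
  "tv_dist S p q = Max ((\<lambda>A. \<bar>measure_pmf.prob p A - measure_pmf.prob q A\<bar>) ` Pow S)"

end

theory Submission
  imports Defs
begin

text \<open>Since all flip rates are at most 1, \<open>P = I + L / |G|\<close> is a Markov kernel with the same
  stationary measures as the generator \<open>L\<close>: it refreshes a uniformly chosen site, which either copies
  the spin of a random neighbour or, with probability \<open>2\<delta> / (2\<delta> + 1)\<close>, takes a fair coin flip.
  If \<open>a x\<close> bounds the influence of the spin at \<open>x\<close> on \<open>f\<close>, then \<open>P f\<close> has influence bounded by an
  explicit linear image of \<open>a\<close>, which only moves mass between neighbours. The coin flips make this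
  linear map a contraction by \<open>1 - \<kappa> / |G|\<close> in every weighted sum whose weights vary by a factor of
  at most \<open>1 + \<delta>\<close> between neighbours. With constant weights this gives existence and uniqueness
  of the stationary measure. Changing the boundary spin at \<open>u\<close> perturbs \<open>P f\<close> by at most the
  influence of the neighbours of \<open>u\<close> over \<open>|G|\<close>; summing the perturbations of all iterates with
  weights \<open>(1 + \<delta>) powr - dist(u, x)\<close> gives the exponential decay, the factors \<open>|G|\<close> cancelling.\<close>

section \<open>Distance and neighbours in the lattice\<close>

lemma lattice_dist_triangle: "lattice_dist u w \<le> lattice_dist u v + lattice_dist v w"
  unfolding lattice_dist_def sum.distrib[symmetric] by (intro sum_mono) linarith

lemma lattice_dist_commute: "lattice_dist u v = lattice_dist v u"
  unfolding lattice_dist_def by (simp add: abs_minus_commute)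

lemma not_lattice_adj_self [simp]: "\<not> lattice_adj x x"
  by (simp add: lattice_adj_def lattice_dist_def)

text \<open>Nonnegative integers with sum 1 are all 0 except for a single 1, so a neighbour differs
  from \<open>x\<close> in one coordinate only, by plus or minus 1. The parametrisation by
  coordinate and sign yields the degree 2d.\<close>

lemma neighbours_eq:
  "{y. lattice_adj x y} = (\<lambda>(i, s). x + axis i s) ` (UNIV \<times> {-1, 1})"
proof (intro set_eqI iffI)
  fix y assume "y \<in> {y. lattice_adj x y}"
  then have sum1: "(\<Sum>i\<in>UNIV. \<bar>x $ i - y $ i\<bar>) = 1"
    by (simp add: lattice_adj_def lattice_dist_def)
  then obtain k where k: "x $ k \<noteq> y $ k"
    by (cases "\<forall>i. x $ i = y $ i") auto
  have split: "\<bar>x $ k - y $ k\<bar> + (\<Sum>i\<in>UNIV - {k}. \<bar>x $ i - y $ i\<bar>) = 1"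
    using sum1 sum.remove[of UNIV k "\<lambda>i. \<bar>x $ i - y $ i\<bar>"] by simp
  moreover have "(\<Sum>i\<in>UNIV - {k}. \<bar>x $ i - y $ i\<bar>) \<ge> 0"
    by (intro sum_nonneg) auto
  ultimately have one: "\<bar>x $ k - y $ k\<bar> = 1"
      and "(\<Sum>i\<in>UNIV - {k}. \<bar>x $ i - y $ i\<bar>) = 0"
    using k by linarith+
  then have "x $ i = y $ i" if "i \<noteq> k" for i
    using that by (subst (asm) sum_nonneg_eq_0_iff) auto
  then have "y = x + axis k (y $ k - x $ k)"
    by (auto simp: vec_eq_iff axis_def)
  moreover have "y $ k - x $ k \<in> {-1, 1}"
    using one by auto
  ultimately show "y \<in> (\<lambda>(i, s). x + axis i s) ` (UNIV \<times> {-1, 1})"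
    by (intro image_eqI[of _ _ "(k, y $ k - x $ k)"]) auto
next
  fix y assume "y \<in> (\<lambda>(i, s). x + axis i s) ` (UNIV \<times> {-1, 1})"
  then obtain i s where y: "y = x + axis i s" and s: "s \<in> {-1, 1}"
    by auto
  have "(\<Sum>j\<in>UNIV. \<bar>x $ j - y $ j\<bar>) = (\<Sum>j\<in>UNIV. if j = i then \<bar>s\<bar> else 0)"
    by (intro sum.cong) (auto simp: y axis_def)
  then show "y \<in> {y. lattice_adj x y}"
    using s by (auto simp: lattice_adj_def lattice_dist_def)
qed

lemma finite_neighbours [simp]: "finite {y. lattice_adj x y}"
  by (simp add: neighbours_eq)

lemma card_neighbours: "card {y. lattice_adj (x :: int ^ 'd) y} = 2 * CARD('d)"
proof -
  have "inj_on (\<lambda>(i, s). x + axis i s) (UNIV \<times> {-1, 1})"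
    by (auto simp: inj_on_def axis_eq_axis)
  then show ?thesis
    unfolding neighbours_eq by (subst card_image) (simp_all add: card_cartesian_product)
qed

section \<open>Configurations, finite expectations and a fact on power series\<close>

lemma finite_configs: "finite V \<Longrightarrow> finite (configs V)"
  by (simp add: configs_def finite_PiE)

lemma configs_nonempty: "configs V \<noteq> {}"
  by (simp add: configs_def PiE_eq_empty_iff)

lemma configs_upd: "\<eta> \<in> configs V \<Longrightarrow> x \<in> V \<Longrightarrow> \<eta>(x := s) \<in> configs V"
  by (auto simp: configs_def PiE_def extensional_def)

lemma expectation_abs_le:
  fixes f :: "'a \<Rightarrow> real"
  assumes "finite (set_pmf \<mu>)" and "\<And>x. x \<in> set_pmf \<mu> \<Longrightarrow> \<bar>f x\<bar> \<le> b"
  shows "\<bar>measure_pmf.expectation \<mu> f\<bar> \<le> b"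
proof -
  have int: "integrable \<mu> f" "integrable \<mu> (\<lambda>x. \<bar>f x\<bar>)"
    using assms(1) by (auto intro: integrable_measure_pmf_finite)
  have "\<bar>measure_pmf.expectation \<mu> f\<bar> \<le> measure_pmf.expectation \<mu> (\<lambda>x. \<bar>f x\<bar>)"
    by (rule integral_abs_bound)
  also have "\<dots> \<le> measure_pmf.expectation \<mu> (\<lambda>_. b)"
    using int(2) assms(2) by (intro integral_mono_AE) (auto simp: AE_measure_pmf_iff)
  finally show ?thesis by simp
qed

text \<open>Averaging over the independent coupling, in two stages: for each fixed \<open>y\<close>
  the bound is integrated over \<mu>, then the result over \<nu>.\<close>

lemma expectation_diff_le_oscillation:
  fixes f :: "'a \<Rightarrow> real"
  assumes fin: "finite (set_pmf \<mu>)" "finite (set_pmf \<nu>)"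
    and osc: "\<And>x y. x \<in> set_pmf \<mu> \<Longrightarrow> y \<in> set_pmf \<nu> \<Longrightarrow> \<bar>f x - f y\<bar> \<le> b"
  shows "\<bar>measure_pmf.expectation \<mu> f - measure_pmf.expectation \<nu> f\<bar> \<le> b"
proof -
  have int: "integrable \<mu> f" "integrable \<nu> f"
    using fin by (auto intro: integrable_measure_pmf_finite)
  have "\<bar>measure_pmf.expectation \<mu> f - f y\<bar> \<le> b" if "y \<in> set_pmf \<nu>" for y
    using expectation_abs_le[OF fin(1), of "\<lambda>x. f x - f y" b] osc that int by simp
  then show ?thesis
    using expectation_abs_le[OF fin(2), of "\<lambda>y. measure_pmf.expectation \<mu> f - f y" b] int by simp
qed

text \<open>Summability at \<open>t = 1\<close> makes the series differentiable at 0 with derivative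
  \<open>c 1\<close>. Stationarity speaks of times \<open>t \<ge> 0\<close> only, so this derivative
  is computed from the right, where all difference quotients vanish.\<close>

lemma powser_const_imp_coeff_1_eq_0:
  fixes c :: "nat \<Rightarrow> real"
  assumes "summable c" and const: "\<And>t. t \<ge> 0 \<Longrightarrow> (\<Sum>n. c n * t ^ n) = k"
  shows "c 1 = 0"
proof -
  define h where "h = (\<lambda>t. \<Sum>n. c n * t ^ n)"
  have "DERIV (\<lambda>t. \<Sum>n. c n * t ^ n) 0 :> (\<Sum>n. diffs c n * 0 ^ n)"
    using assms(1) by (intro termdiffs_strong[of c 1]) auto
  then have "DERIV h 0 :> c 1"
    by (simp add: h_def diffs_def)
  then have "((\<lambda>t. (h t - h 0) / (t - 0)) \<longlongrightarrow> c 1) (at 0)"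
    by (simp add: has_field_derivative_iff)
  then have "((\<lambda>t. (h t - h 0) / (t - 0)) \<longlongrightarrow> c 1) (at_right 0)"
    by (rule tendsto_within_subset) simp
  moreover have "h t = k" if "t \<ge> 0" for t
    using const[OF that] by (simp add: h_def)
  then have "eventually (\<lambda>t. (h t - h 0) / (t - 0) = 0) (at_right 0)"
    by (intro eventually_mono[OF eventually_at_right_less]) simp
  ultimately have "((\<lambda>_. 0) \<longlongrightarrow> c 1) (at_right (0 :: real))"
    by (rule Lim_transform_eventually)
  then show ?thesis
    by (simp add: tendsto_const_iff)
qed

section \<open>Rates and the discrete-time kernel\<close>

locale noisy_voter =
  fixes \<delta> :: real and G :: "(int ^ 'd) set"
  assumes \<delta>_pos: "\<delta> > 0" and finite_G: "finite G" and G_nonempty: "G \<noteq> {}"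
begin

abbreviation N :: real where "N \<equiv> real (card G)"

text \<open>\<alpha> is the rate at which a site copies one given neighbour, \<beta> the rate at
  which it is reset to one given spin value. \<beta> and \<kappa> are the same number in different
  roles.\<close>

definition \<alpha> :: real where "\<alpha> = 1 / ((2 * \<delta> + 1) * (2 * real CARD('d)))"
definition \<beta> :: real where "\<beta> = \<delta> / (2 * \<delta> + 1)"

text \<open>\<open>1 - \<kappa> = (1 + \<delta>) / (2\<delta> + 1)\<close> is the probability of copying a neighbour, times the largest
  ratio allowed in \<open>slowly_varying\<close> below.\<close>

definition \<kappa> :: real where "\<kappa> = \<delta> / (2 * \<delta> + 1)"

lemma N_ge_1: "N \<ge> 1"
  using finite_G G_nonempty by (simp add: Suc_leI card_gt_0_iff)

lemma \<alpha>_pos: "\<alpha> > 0" and \<beta>_pos: "\<beta> > 0" and \<kappa>_pos: "\<kappa> > 0" and \<kappa>_le_1: "\<kappa> \<le> 1"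
  using \<delta>_pos by (simp_all add: \<alpha>_def \<beta>_def \<kappa>_def)

lemma two_d_\<alpha>: "\<alpha> * (2 * real CARD('d)) = 1 / (2 * \<delta> + 1)"
  by (simp add: \<alpha>_def)

text \<open>Copying one of the 2d neighbours and resetting to one of the two values exhaust the
  updates of a site. The total rate 1 turns \<open>site_update\<close> into a probability
  average.\<close>

lemma rates_sum: "\<alpha> * real (card {y. lattice_adj (x :: int ^ 'd) y}) + 2 * \<beta> = 1"
proof -
  have "1 / (2 * \<delta> + 1) + 2 * \<beta> = 1"
    using \<delta>_pos by (simp add: \<beta>_def field_simps)
  then show ?thesis
    using two_d_\<alpha> by (simp add: card_neighbours)
qed

lemma flip_rate_eq:
  "x \<in> G \<Longrightarrow> flip_rate \<delta> G \<tau> x \<eta> =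
    \<alpha> * real (card {y. lattice_adj x y \<and> with_boundary G \<tau> \<eta> y \<noteq> \<eta> x}) + \<beta>"
  by (simp add: flip_rate_def \<alpha>_def \<beta>_def distrib_left with_boundary_def[of G \<tau> \<eta> x])

lemma flip_rate_nonneg: "x \<in> G \<Longrightarrow> flip_rate \<delta> G \<tau> x \<eta> \<ge> 0"
  using \<alpha>_pos \<beta>_pos by (simp add: flip_rate_eq)

lemma flip_rate_le_1:
  assumes "x \<in> G"
  shows "flip_rate \<delta> G \<tau> x \<eta> \<le> 1"
proof -
  have "card {y. lattice_adj x y \<and> with_boundary G \<tau> \<eta> y \<noteq> \<eta> x} \<le> card {y. lattice_adj x y}"
    by (intro card_mono) auto
  then have "\<alpha> * real (card {y. lattice_adj x y \<and> with_boundary G \<tau> \<eta> y \<noteq> \<eta> x})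
      \<le> \<alpha> * real (card {y. lattice_adj x y})"
    using \<alpha>_pos by simp
  then show ?thesis
    using rates_sum[of x] \<beta>_pos by (simp add: flip_rate_eq[OF assms])
qed

definition step ::
    "(int ^ 'd \<Rightarrow> bool) \<Rightarrow> ((int ^ 'd \<Rightarrow> bool) \<Rightarrow> real) \<Rightarrow> (int ^ 'd \<Rightarrow> bool) \<Rightarrow> real" where
  "step \<tau> f \<eta> = f \<eta> + noisy_voter_generator \<delta> G \<tau> f \<eta> / N"

text \<open>The flip rates rewritten as a mixture of copying a neighbour and resetting to a fixed value:
  in this form the updated value of \<open>x\<close> visibly does not depend on its old one.\<close>

definition site_update ::
    "(int ^ 'd \<Rightarrow> bool) \<Rightarrow> int ^ 'd \<Rightarrow> ((int ^ 'd \<Rightarrow> bool) \<Rightarrow> real) \<Rightarrow> (int ^ 'd \<Rightarrow> bool) \<Rightarrow> real" where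
  "site_update \<tau> x f \<eta> =
     \<alpha> * (\<Sum>y | lattice_adj x y. f (\<eta>(x := with_boundary G \<tau> \<eta> y)))
     + \<beta> * (f (\<eta>(x := True)) + f (\<eta>(x := False)))"

text \<open>Updates that keep the spin contribute nothing to the difference. Copying flips
  \<open>x\<close> exactly when the neighbour disagrees, and exactly one of the two resets flips
  it.\<close>

lemma site_update_eq:
  assumes "x \<in> G"
  shows "site_update \<tau> x f \<eta> - f \<eta> = flip_rate \<delta> G \<tau> x \<eta> * (f (\<eta>(x := \<not> \<eta> x)) - f \<eta>)"
proof -
  define D where "D = f (\<eta>(x := \<not> \<eta> x)) - f \<eta>"
  have upd: "f (\<eta>(x := s)) = f \<eta> + of_bool (s \<noteq> \<eta> x) * D" for s
  proof (cases "s = \<eta> x")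
    case True
    then show ?thesis by simp
  next
    case False
    then have "s = (\<not> \<eta> x)" by simp
    then show ?thesis by (simp add: D_def)
  qed
  have 1: "(\<Sum>y | lattice_adj x y. f (\<eta>(x := with_boundary G \<tau> \<eta> y))) =
      real (card {y. lattice_adj x y}) * f \<eta>
      + real (card {y. lattice_adj x y \<and> with_boundary G \<tau> \<eta> y \<noteq> \<eta> x}) * D"
    unfolding upd by (simp add: sum.distrib sum_distrib_right[symmetric] Int_def)
  have 2: "f (\<eta>(x := True)) + f (\<eta>(x := False)) = 2 * f \<eta> + D"
    unfolding upd by (cases "\<eta> x") simp_all
  have "site_update \<tau> x f \<eta> =
      (\<alpha> * real (card {y. lattice_adj x y}) + 2 * \<beta>) * f \<eta> + flip_rate \<delta> G \<tau> x \<eta> * D"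
    unfolding site_update_def 1 2 flip_rate_eq[OF assms] by (simp add: algebra_simps)
  then show ?thesis
    by (simp add: rates_sum D_def)
qed

text \<open>As every site updates at total rate 1, the identity part of \<open>step\<close> cancels.
  What remains is the average over a uniformly chosen site, from which positivity and influence
  bounds can be read off.\<close>

lemma step_eq: "step \<tau> f \<eta> = (\<Sum>x\<in>G. site_update \<tau> x f \<eta>) / N"
proof -
  have "noisy_voter_generator \<delta> G \<tau> f \<eta> = (\<Sum>x\<in>G. site_update \<tau> x f \<eta> - f \<eta>)"
    unfolding noisy_voter_generator_def by (intro sum.cong refl) (simp add: site_update_eq)
  then show ?thesis
    using N_ge_1 by (simp add: step_def sum_subtractf field_simps)
qed

section \<open>Influence vectors and their propagation\<close>

text \<open>A vector bounding, site by site, the influence of a spin on \<open>f\<close>. It does not depend on the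
  boundary condition, so it serves to compare the dynamics for two of them.\<close>

definition influence_le :: "((int ^ 'd \<Rightarrow> bool) \<Rightarrow> real) \<Rightarrow> (int ^ 'd \<Rightarrow> real) \<Rightarrow> bool" where
  "influence_le f a \<longleftrightarrow> (\<forall>\<eta>\<in>configs G. \<forall>x\<in>G. \<bar>f (\<eta>(x := \<not> \<eta> x)) - f \<eta>\<bar> \<le> a x)"

lemma influence_leD:
  "influence_le f a \<Longrightarrow> \<eta> \<in> configs G \<Longrightarrow> x \<in> G \<Longrightarrow> \<bar>f (\<eta>(x := \<not> \<eta> x)) - f \<eta>\<bar> \<le> a x"
  by (simp add: influence_le_def)

lemma influence_le_nonneg:
  assumes "influence_le f a" "x \<in> G"
  shows "a x \<ge> 0"
proof -
  obtain \<eta> where "\<eta> \<in> configs G"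
    using configs_nonempty by blast
  then show ?thesis
    using influence_leD[OF assms(1) _ assms(2), of \<eta>] by linarith
qed

lemma influence_le_upd:
  assumes a: "influence_le f a" and \<eta>: "\<eta> \<in> configs G" and x: "x \<in> G"
  shows "\<bar>f (\<eta>(x := s)) - f (\<eta>(x := s'))\<bar> \<le> a x"
proof (cases "s = s'")
  case True
  then show ?thesis using influence_le_nonneg[OF a x] by simp
next
  case False
  then have "\<eta>(x := s) = (\<eta>(x := s'))(x := \<not> (\<eta>(x := s')) x)"
    by auto
  then show ?thesis
    using influence_leD[OF a configs_upd[OF \<eta> x, of s'] x] by simp
qed

text \<open>A path from \<zeta> to \<eta> changes one site of \<open>G\<close> at a time;
  \<open>override_on \<zeta> \<eta> A\<close> is the point on it where the sites in \<open>A\<close>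
  have been changed.\<close>

lemma oscillation_le:
  assumes a: "influence_le f a" and \<eta>: "\<eta> \<in> configs G" and \<zeta>: "\<zeta> \<in> configs G"
  shows "\<bar>f \<eta> - f \<zeta>\<bar> \<le> (\<Sum>x\<in>G. a x)"
proof -
  have "\<bar>f (override_on \<zeta> \<eta> A) - f \<zeta>\<bar> \<le> (\<Sum>x\<in>A. a x)" if "A \<subseteq> G" for A
    using finite_subset[OF that finite_G] that
  proof (induction A rule: finite_induct)
    case empty
    then show ?case by simp
  next
    case (insert x A)
    let ?\<xi> = "override_on \<zeta> \<eta> A"
    have "?\<xi> \<in> configs G"
      using \<eta> \<zeta> by (auto simp: configs_def PiE_def extensional_def override_on_def)
    then have "\<bar>f (?\<xi>(x := \<eta> x)) - f (?\<xi>(x := ?\<xi> x))\<bar> \<le> a x"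
      using insert.prems by (intro influence_le_upd[OF a]) auto
    then have "\<bar>f (?\<xi>(x := \<eta> x)) - f ?\<xi>\<bar> \<le> a x"
      by (simp only: fun_upd_triv)
    moreover have "\<bar>f ?\<xi> - f \<zeta>\<bar> \<le> (\<Sum>x\<in>A. a x)"
      using insert by simp
    ultimately show ?case
      unfolding override_on_insert sum.insert[OF insert.hyps] by linarith
  qed
  moreover have "override_on \<zeta> \<eta> G = \<eta>"
    using \<eta> \<zeta> by (auto simp: configs_def PiE_def extensional_def override_on_def)
  ultimately show ?thesis
    by (metis order_refl)
qed

text \<open>After one move the spin at \<open>z\<close> still acts directly unless \<open>z\<close>
  was refreshed, and it acts through each neighbour \<open>x\<close> in \<open>G\<close> that was
  refreshed by copying \<open>z\<close>, which has probability \<open>\<alpha> / N\<close>.\<close>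

definition spread :: "(int ^ 'd \<Rightarrow> real) \<Rightarrow> int ^ 'd \<Rightarrow> real" where
  "spread a z = (1 - 1 / N) * a z + \<alpha> / N * (\<Sum>x\<in>G. of_bool (lattice_adj x z) * a x)"

text \<open>Refreshing \<open>z\<close> forgets its old spin, because no site is its own neighbour.
  Refreshing another site \<open>x\<close> keeps the influence of \<open>z\<close> and adds that of
  \<open>x\<close> only in the event that \<open>x\<close> copies \<open>z\<close>.\<close>

lemma site_update_influence:
  assumes a: "influence_le f a" and \<eta>: "\<eta> \<in> configs G" and x: "x \<in> G" and z: "z \<in> G"
  shows "\<bar>site_update \<tau> x f (\<eta>(z := \<not> \<eta> z)) - site_update \<tau> x f \<eta>\<bar>
    \<le> of_bool (x \<noteq> z) * a z + \<alpha> * (of_bool (lattice_adj x z) * a x)"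
proof (cases "x = z")
  case True
  have nb: "with_boundary G \<tau> (\<eta>(z := \<not> \<eta> z)) y = with_boundary G \<tau> \<eta> y"
    if "lattice_adj z y" for y
    using that by (auto simp: with_boundary_def)
  have "(\<Sum>y | lattice_adj z y. f (\<eta>(z := with_boundary G \<tau> (\<eta>(z := \<not> \<eta> z)) y))) =
      (\<Sum>y | lattice_adj z y. f (\<eta>(z := with_boundary G \<tau> \<eta> y)))"
    by (intro sum.cong refl) (simp add: nb)
  then have "site_update \<tau> x f (\<eta>(z := \<not> \<eta> z)) = site_update \<tau> x f \<eta>"
    unfolding site_update_def True fun_upd_upd by (simp only:)
  then show ?thesis
    using True by simp
next
  case False
  let ?\<zeta> = "\<eta>(z := \<not> \<eta> z)"
  have same: "\<bar>f (?\<zeta>(x := s)) - f (\<eta>(x := s))\<bar> \<le> a z" for s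
    using influence_leD[OF a configs_upd[OF \<eta> x, of s] z] False by (simp add: fun_upd_twist)
  have nb: "\<bar>f (?\<zeta>(x := with_boundary G \<tau> ?\<zeta> y)) - f (\<eta>(x := with_boundary G \<tau> \<eta> y))\<bar>
      \<le> a z + of_bool (y = z) * a x" for y
  proof (cases "y = z")
    case True
    then show ?thesis
      using same[of "with_boundary G \<tau> ?\<zeta> y"]
        influence_le_upd[OF a \<eta> x, of "with_boundary G \<tau> ?\<zeta> y" "with_boundary G \<tau> \<eta> y"]
      by simp
  next
    case False
    then have "with_boundary G \<tau> ?\<zeta> y = with_boundary G \<tau> \<eta> y"
      by (simp add: with_boundary_def)
    then show ?thesis
      using same False by simp
  qed
  have "\<bar>site_update \<tau> x f ?\<zeta> - site_update \<tau> x f \<eta>\<bar> =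
      \<bar>\<alpha> * (\<Sum>y | lattice_adj x y.
          f (?\<zeta>(x := with_boundary G \<tau> ?\<zeta> y)) - f (\<eta>(x := with_boundary G \<tau> \<eta> y)))
        + \<beta> * ((f (?\<zeta>(x := True)) - f (\<eta>(x := True))) + (f (?\<zeta>(x := False)) - f (\<eta>(x := False))))\<bar>"
    unfolding site_update_def sum_subtractf by (simp add: algebra_simps)
  also have "\<dots> \<le> \<alpha> * (\<Sum>y | lattice_adj x y. a z + of_bool (y = z) * a x) + \<beta> * (a z + a z)"
  proof (rule order_trans[OF abs_triangle_ineq add_mono])
    show "\<bar>\<alpha> * (\<Sum>y | lattice_adj x y.
          f (?\<zeta>(x := with_boundary G \<tau> ?\<zeta> y)) - f (\<eta>(x := with_boundary G \<tau> \<eta> y)))\<bar>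
        \<le> \<alpha> * (\<Sum>y | lattice_adj x y. a z + of_bool (y = z) * a x)"
      unfolding abs_mult using \<alpha>_pos nb
      by (auto intro!: mult_left_mono order_trans[OF sum_abs] sum_mono)
    show "\<bar>\<beta> * ((f (?\<zeta>(x := True)) - f (\<eta>(x := True)))
          + (f (?\<zeta>(x := False)) - f (\<eta>(x := False))))\<bar> \<le> \<beta> * (a z + a z)"
      unfolding abs_mult using \<beta>_pos same[of True] same[of False]
      by (intro mult_mono) auto
  qed
  also have "(\<Sum>y | lattice_adj x y. a z + of_bool (y = z) * a x) =
      real (card {y. lattice_adj x y}) * a z + of_bool (lattice_adj x z) * a x"
    by (simp add: sum.distrib sum_distrib_right[symmetric] of_bool_def sum.delta)
  also have "\<alpha> * (real (card {y. lattice_adj x y}) * a z + of_bool (lattice_adj x z) * a x) + \<beta> * (a z + a z)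
      = (\<alpha> * real (card {y. lattice_adj x y}) + 2 * \<beta>) * a z + \<alpha> * (of_bool (lattice_adj x z) * a x)"
    by (simp add: algebra_simps)
  finally have "\<bar>site_update \<tau> x f ?\<zeta> - site_update \<tau> x f \<eta>\<bar> \<le>
      a z + \<alpha> * (of_bool (lattice_adj x z) * a x)"
    by (simp only: rates_sum mult_1)
  then show ?thesis
    using False by (simp del: fun_upd_apply)
qed

lemma influence_le_step:
  assumes "influence_le f a"
  shows "influence_le (step \<tau> f) (spread a)"
  unfolding influence_le_def
proof (intro ballI)
  fix \<eta> z assume \<eta>: "\<eta> \<in> configs G" and z: "z \<in> G"
  have "\<bar>step \<tau> f (\<eta>(z := \<not> \<eta> z)) - step \<tau> f \<eta>\<bar> =
      \<bar>\<Sum>x\<in>G. site_update \<tau> x f (\<eta>(z := \<not> \<eta> z)) - site_update \<tau> x f \<eta>\<bar> / N"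
    using N_ge_1 by (simp add: step_eq sum_subtractf diff_divide_distrib[symmetric])
  also have "\<dots> \<le> (\<Sum>x\<in>G. of_bool (x \<noteq> z) * a z + \<alpha> * (of_bool (lattice_adj x z) * a x)) / N"
    by (intro divide_right_mono order_trans[OF sum_abs] sum_mono
          site_update_influence[OF assms \<eta> _ z]) auto
  also have "\<dots> = spread a z"
  proof -
    have "(\<Sum>x\<in>G. of_bool (x \<noteq> z)) = N - 1"
      using finite_G z N_ge_1 sum.remove[OF finite_G z, of "\<lambda>x. of_bool (x \<noteq> z) :: real"]
      by (simp add: card_Diff_singleton of_nat_diff)
    then have "(\<Sum>x\<in>G. of_bool (x \<noteq> z) * a z) = (N - 1) * a z"
      by (simp only: sum_distrib_right[symmetric])
    moreover have "(N - 1) * a z / N = (1 - 1 / N) * a z"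
      using N_ge_1 by (simp add: diff_divide_distrib left_diff_distrib)
    ultimately show ?thesis
      by (simp only: spread_def sum.distrib sum_distrib_left[symmetric] add_divide_distrib
          times_divide_eq_left)
  qed
  finally show "\<bar>step \<tau> f (\<eta>(z := \<not> \<eta> z)) - step \<tau> f \<eta>\<bar> \<le> spread a z" .
qed

lemma influence_le_funpow:
  "influence_le f a \<Longrightarrow> influence_le ((step \<tau> ^^ n) f) ((spread ^^ n) a)"
  by (induction n) (auto intro: influence_le_step)

section \<open>Contraction of weighted influence\<close>

text \<open>The ratio \<open>1 + \<delta>\<close> exceeds 1, so that weights may decay
  exponentially, but stays below \<open>2 * \<delta> + 1\<close>, the inverse of the probability of
  copying, so that the sum still contracts.\<close>

definition slowly_varying :: "(int ^ 'd \<Rightarrow> real) \<Rightarrow> bool" where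
  "slowly_varying w \<longleftrightarrow> (\<forall>x. w x \<ge> 0) \<and> (\<forall>x y. lattice_adj x y \<longrightarrow> w y \<le> (1 + \<delta>) * w x)"

definition q :: real where "q = 1 - \<kappa> / N"

lemma q_nonneg: "q \<ge> 0" and q_less_1: "q < 1"
  using N_ge_1 \<kappa>_pos \<kappa>_le_1 by (simp_all add: q_def field_simps)

text \<open>Exchanging the sums counts mass where it is sent instead of where it arrives: a
  refreshed site \<open>x\<close> passes \<open>a x\<close> to its 2d neighbours with coefficient
  \<alpha>, and their weights are at most \<open>(1 + \<delta>) * w x\<close>. Only one of
  \<open>N\<close> sites is refreshed, hence the factor \<open>q\<close>.\<close>

lemma weighted_sum_spread:
  assumes w: "slowly_varying w" and a: "\<And>x. x \<in> G \<Longrightarrow> a x \<ge> 0"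
  shows "(\<Sum>z\<in>G. w z * spread a z) \<le> q * (\<Sum>z\<in>G. w z * a z)"
proof -
  have nb: "\<alpha> * (\<Sum>z\<in>G. of_bool (lattice_adj x z) * w z) \<le> (1 - \<kappa>) * w x" for x
  proof -
    have "(\<Sum>z\<in>G. of_bool (lattice_adj x z) * w z) = (\<Sum>z\<in>{z\<in>G. lattice_adj x z}. w z)"
      using finite_G by (simp add: sum.inter_filter of_bool_def if_distrib[of "\<lambda>b. b * _"] cong: if_cong)
    also have "\<dots> \<le> (\<Sum>z | lattice_adj x z. w z)"
      using w by (intro sum_mono2) (auto simp: slowly_varying_def)
    also have "\<dots> \<le> (\<Sum>z | lattice_adj x z. (1 + \<delta>) * w x)"
      using w by (intro sum_mono) (auto simp: slowly_varying_def)
    also have "\<dots> = 2 * real CARD('d) * ((1 + \<delta>) * w x)"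
      by (simp add: card_neighbours)
    finally have "\<alpha> * (\<Sum>z\<in>G. of_bool (lattice_adj x z) * w z)
        \<le> \<alpha> * (2 * real CARD('d) * ((1 + \<delta>) * w x))"
      using \<alpha>_pos by simp
    also have "\<dots> = (\<alpha> * (2 * real CARD('d)) * (1 + \<delta>)) * w x"
      by simp
    also have "\<alpha> * (2 * real CARD('d)) * (1 + \<delta>) = 1 - \<kappa>"
      unfolding two_d_\<alpha> using \<delta>_pos by (simp add: \<kappa>_def field_simps)
    finally show ?thesis .
  qed
  have "(\<Sum>z\<in>G. w z * spread a z) = (1 - 1 / N) * (\<Sum>z\<in>G. w z * a z)
      + (\<Sum>z\<in>G. \<Sum>x\<in>G. \<alpha> / N * (of_bool (lattice_adj x z) * a x * w z))"
    by (simp add: spread_def distrib_left sum.distrib sum_distrib_left mult_ac)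
  also have "(\<Sum>z\<in>G. \<Sum>x\<in>G. \<alpha> / N * (of_bool (lattice_adj x z) * a x * w z)) =
      (\<Sum>x\<in>G. a x / N * (\<alpha> * (\<Sum>z\<in>G. of_bool (lattice_adj x z) * w z)))"
    by (subst sum.swap) (simp add: sum_distrib_left algebra_simps)
  also have "\<dots> \<le> (\<Sum>x\<in>G. a x / N * ((1 - \<kappa>) * w x))"
    using a N_ge_1 by (intro sum_mono mult_left_mono nb) auto
  also have "\<dots> = (1 - \<kappa>) / N * (\<Sum>z\<in>G. w z * a z)"
    unfolding sum_distrib_left by (intro sum.cong refl) simp
  also have "(1 - 1 / N) * (\<Sum>z\<in>G. w z * a z) + \<dots> = q * (\<Sum>z\<in>G. w z * a z)"
    by (simp add: q_def algebra_simps diff_divide_distrib)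
  finally show ?thesis by simp
qed

lemma weighted_sum_funpow_spread:
  assumes w: "slowly_varying w" and a: "influence_le f a"
  shows "(\<Sum>z\<in>G. w z * (spread ^^ n) a z) \<le> q ^ n * (\<Sum>z\<in>G. w z * a z)"
proof (induction n)
  case 0
  then show ?case by simp
next
  case (Suc n)
  have "(\<Sum>z\<in>G. w z * (spread ^^ Suc n) a z) \<le> q * (\<Sum>z\<in>G. w z * (spread ^^ n) a z)"
    using weighted_sum_spread[OF w, of "(spread ^^ n) a"]
      influence_le_nonneg[OF influence_le_funpow[OF a]] by simp
  also have "\<dots> \<le> q * (q ^ n * (\<Sum>z\<in>G. w z * a z))"
    using Suc q_nonneg by (rule mult_left_mono)
  finally show ?case by simp
qed

lemma sum_funpow_spread:
  assumes "influence_le f a"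
  shows "(\<Sum>z\<in>G. (spread ^^ n) a z) \<le> q ^ n * (\<Sum>z\<in>G. a z)"
  using weighted_sum_funpow_spread[of "\<lambda>_. 1", OF _ assms] \<delta>_pos by (simp add: slowly_varying_def)

section \<open>Bounds and linearity for the generator and the kernel\<close>

lemma ex_influence_le: "\<exists>a. influence_le f a"
proof
  have fin: "finite (configs G)"
    using finite_G by (rule finite_configs)
  have le: "\<bar>f \<eta>\<bar> \<le> (\<Sum>\<zeta>\<in>configs G. \<bar>f \<zeta>\<bar>)" if "\<eta> \<in> configs G" for \<eta>
    using that fin by (intro member_le_sum) auto
  show "influence_le f (\<lambda>_. 2 * (\<Sum>\<zeta>\<in>configs G. \<bar>f \<zeta>\<bar>))"
    unfolding influence_le_def
  proof (intro ballI)
    fix \<eta> x assume "\<eta> \<in> configs G" "x \<in> G"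
    then show "\<bar>f (\<eta>(x := \<not> \<eta> x)) - f \<eta>\<bar> \<le> 2 * (\<Sum>\<zeta>\<in>configs G. \<bar>f \<zeta>\<bar>)"
      using le[of \<eta>] le[of "\<eta>(x := \<not> \<eta> x)"] configs_upd by fastforce
  qed
qed

lemma generator_cong:
  assumes "\<And>\<eta>. \<eta> \<in> configs G \<Longrightarrow> f \<eta> = g \<eta>" "\<eta> \<in> configs G"
  shows "noisy_voter_generator \<delta> G \<tau> f \<eta> = noisy_voter_generator \<delta> G \<tau> g \<eta>"
  unfolding noisy_voter_generator_def
  by (intro sum.cong refl) (simp add: assms configs_upd del: fun_upd_apply)

lemma generator_const [simp]: "noisy_voter_generator \<delta> G \<tau> (\<lambda>_. c) \<eta> = 0"
  by (simp add: noisy_voter_generator_def)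

lemma generator_sum:
  "noisy_voter_generator \<delta> G \<tau> (\<lambda>\<eta>. \<Sum>i\<in>I. c i * g i \<eta>) \<eta> =
    (\<Sum>i\<in>I. c i * noisy_voter_generator \<delta> G \<tau> (g i) \<eta>)"
  unfolding noisy_voter_generator_def sum_subtractf[symmetric] sum_distrib_left
  by (subst sum.swap) (simp add: algebra_simps)

lemma generator_abs_le_sum_influence:
  assumes "influence_le f a" "\<eta> \<in> configs G"
  shows "\<bar>noisy_voter_generator \<delta> G \<tau> f \<eta>\<bar> \<le> (\<Sum>x\<in>G. a x)"
  unfolding noisy_voter_generator_def
proof (intro order_trans[OF sum_abs] sum_mono)
  fix x assume x: "x \<in> G"
  show "\<bar>flip_rate \<delta> G \<tau> x \<eta> * (f (\<eta>(x := \<not> \<eta> x)) - f \<eta>)\<bar> \<le> a x"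
    using mult_mono[OF flip_rate_le_1[OF x, of \<tau> \<eta>] influence_leD[OF assms x]]
      flip_rate_nonneg[OF x, of \<tau> \<eta>]
    by (simp add: abs_mult)
qed

lemma generator_abs_le:
  assumes "\<And>\<eta>. \<eta> \<in> configs G \<Longrightarrow> \<bar>f \<eta>\<bar> \<le> M" "\<eta> \<in> configs G"
  shows "\<bar>noisy_voter_generator \<delta> G \<tau> f \<eta>\<bar> \<le> 2 * N * M"
proof -
  have "influence_le f (\<lambda>_. 2 * M)"
    unfolding influence_le_def
  proof (intro ballI)
    fix \<eta> x assume "\<eta> \<in> configs G" "x \<in> G"
    then show "\<bar>f (\<eta>(x := \<not> \<eta> x)) - f \<eta>\<bar> \<le> 2 * M"
      using assms(1)[of \<eta>] assms(1)[of "\<eta>(x := \<not> \<eta> x)"] configs_upd by fastforce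
  qed
  then show ?thesis
    using generator_abs_le_sum_influence[OF _ assms(2), of f "\<lambda>_. 2 * M" \<tau>] by (simp add: mult_ac)
qed

text \<open>In the supremum norm over \<open>configs G\<close> the generator has norm at most
  \<open>2 * N\<close>, so the exponential series of the semigroup converges absolutely.\<close>

lemma generator_funpow_abs_le:
  assumes "\<And>\<eta>. \<eta> \<in> configs G \<Longrightarrow> \<bar>f \<eta>\<bar> \<le> M" "\<eta> \<in> configs G"
  shows "\<bar>(noisy_voter_generator \<delta> G \<tau> ^^ n) f \<eta>\<bar> \<le> (2 * N) ^ n * M"
  using assms(2)
proof (induction n arbitrary: \<eta>)
  case 0
  then show ?case using assms(1) by simp
next
  case (Suc n)
  then show ?case
    using generator_abs_le[of "(noisy_voter_generator \<delta> G \<tau> ^^ n) f" "(2 * N) ^ n * M" \<eta> \<tau>]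
    by (simp add: mult.assoc)
qed

lemma step_cong:
  assumes "\<And>\<eta>. \<eta> \<in> configs G \<Longrightarrow> f \<eta> = g \<eta>" "\<eta> \<in> configs G"
  shows "step \<tau> f \<eta> = step \<tau> g \<eta>"
  unfolding step_def using assms generator_cong[of f g \<eta> \<tau>] by simp

lemma step_sum: "step \<tau> (\<lambda>\<eta>. \<Sum>i\<in>I. c i * g i \<eta>) \<eta> = (\<Sum>i\<in>I. c i * step \<tau> (g i) \<eta>)"
  unfolding step_def generator_sum
  by (simp add: distrib_left sum.distrib sum_divide_distrib)

lemma step_nonneg:
  assumes "\<And>\<eta>. \<eta> \<in> configs G \<Longrightarrow> f \<eta> \<ge> 0" "\<eta> \<in> configs G"
  shows "step \<tau> f \<eta> \<ge> 0"
  unfolding step_eq site_update_def using \<alpha>_pos \<beta>_pos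
  by (intro divide_nonneg_nonneg sum_nonneg add_nonneg_nonneg mult_nonneg_nonneg
        assms(1) configs_upd[OF assms(2)]) auto

lemma step_funpow_nonneg:
  assumes "\<And>\<eta>. \<eta> \<in> configs G \<Longrightarrow> f \<eta> \<ge> 0" "\<eta> \<in> configs G"
  shows "(step \<tau> ^^ n) f \<eta> \<ge> 0"
  using assms(2)
  by (induction n arbitrary: \<eta>) (auto intro: assms(1) step_nonneg)

lemma step_funpow_const: "(step \<tau> ^^ n) (\<lambda>_. c) = (\<lambda>_. c)"
proof (induction n)
  case (Suc n)
  have "step \<tau> (\<lambda>_. c) = (\<lambda>_. c)"
    by (simp add: step_def fun_eq_iff)
  with Suc show ?case by simp
qed simp

text \<open>Expansion of \<open>f\<close> in indicators of single configurations; the coefficients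
  of \<open>f \<zeta>\<close> are the n-step transition probabilities from \<eta> to
  \<zeta>.\<close>

lemma step_funpow_eq_sum:
  assumes "\<eta> \<in> configs G"
  shows "(step \<tau> ^^ n) f \<eta> =
    (\<Sum>\<zeta>\<in>configs G. f \<zeta> * (step \<tau> ^^ n) (\<lambda>\<eta>. of_bool (\<eta> = \<zeta>)) \<eta>)"
  using assms
proof (induction n arbitrary: \<eta>)
  case 0
  then show ?case
    using finite_configs[OF finite_G] by (simp add: of_bool_def if_distrib[of "\<lambda>b. _ * b"] cong: if_cong)
next
  case (Suc n)
  have "(step \<tau> ^^ Suc n) f \<eta> = step \<tau> (\<lambda>\<eta>. \<Sum>\<zeta>\<in>configs G.
      f \<zeta> * (step \<tau> ^^ n) (\<lambda>\<eta>. of_bool (\<eta> = \<zeta>)) \<eta>) \<eta>"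
    using Suc by (auto intro: step_cong)
  also have "\<dots> = (\<Sum>\<zeta>\<in>configs G. f \<zeta> * (step \<tau> ^^ Suc n) (\<lambda>\<eta>. of_bool (\<eta> = \<zeta>)) \<eta>)"
    by (simp add: step_sum)
  finally show ?case .
qed

section \<open>Stationarity under the semigroup and invariance under the kernel\<close>

definition invariant :: "(int ^ 'd \<Rightarrow> bool) \<Rightarrow> (int ^ 'd \<Rightarrow> bool) pmf \<Rightarrow> bool" where
  "invariant \<tau> \<mu> \<longleftrightarrow> set_pmf \<mu> \<subseteq> configs G \<and>
    (\<forall>f. measure_pmf.expectation \<mu> (step \<tau> f) = measure_pmf.expectation \<mu> f)"

lemma finite_set_pmf: "set_pmf \<mu> \<subseteq> configs G \<Longrightarrow> finite (set_pmf \<mu>)"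
  using finite_configs[OF finite_G] finite_subset by blast

lemma expectation_eq_sum:
  fixes f :: "(int ^ 'd \<Rightarrow> bool) \<Rightarrow> real"
  shows "set_pmf \<mu> \<subseteq> configs G \<Longrightarrow>
    measure_pmf.expectation \<mu> f = (\<Sum>\<eta>\<in>configs G. f \<eta> * pmf \<mu> \<eta>)"
  using finite_configs[OF finite_G] by (intro integral_measure_pmf_real) auto

lemma invariant_iff_generator:
  assumes \<mu>: "set_pmf \<mu> \<subseteq> configs G"
  shows "invariant \<tau> \<mu> \<longleftrightarrow>
    (\<forall>f. measure_pmf.expectation \<mu> (noisy_voter_generator \<delta> G \<tau> f) = 0)"
proof -
  have int: "integrable \<mu> f" for f :: "(int ^ 'd \<Rightarrow> bool) \<Rightarrow> real"
    using finite_set_pmf[OF \<mu>] by (rule integrable_measure_pmf_finite)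
  have "measure_pmf.expectation \<mu> (step \<tau> f) = measure_pmf.expectation \<mu> f
      + measure_pmf.expectation \<mu> (noisy_voter_generator \<delta> G \<tau> f) / N" for f
    using int by (simp add: step_def[abs_def])
  then show ?thesis
    using \<mu> N_ge_1 G_nonempty finite_G by (simp add: invariant_def)
qed

text \<open>The expectation is a finite sum and may be exchanged with the series. This makes it a
  power series in \<open>t\<close>, summable at 1, whose coefficient at \<open>t\<close> is the
  expectation of the generator.\<close>

lemma expectation_semigroup:
  fixes \<tau> f
  assumes \<mu>: "set_pmf \<mu> \<subseteq> configs G"
  defines "b \<equiv> \<lambda>n. measure_pmf.expectation \<mu> ((noisy_voter_generator \<delta> G \<tau> ^^ n) f) / fact n"
  shows "summable b"
    and "measure_pmf.expectation \<mu> (noisy_voter_semigroup \<delta> G \<tau> t f) = (\<Sum>n. b n * t ^ n)"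
proof -
  define M where "M = (\<Sum>\<zeta>\<in>configs G. \<bar>f \<zeta>\<bar>)"
  have fin: "finite (configs G)"
    using finite_G by (rule finite_configs)
  have M: "\<bar>f \<eta>\<bar> \<le> M" if "\<eta> \<in> configs G" for \<eta>
    unfolding M_def using that fin by (intro member_le_sum) auto
  define T where "T = (\<lambda>\<eta> n. t ^ n / fact n * (noisy_voter_generator \<delta> G \<tau> ^^ n) f \<eta>)"
  have exp_summable: "summable (\<lambda>n. M * (inverse (fact n) * x ^ n))" for x :: real
    by (intro summable_mult summable_exp)
  have "summable (T \<eta>)" if "\<eta> \<in> configs G" for \<eta>
  proof (rule summable_comparison_test'[OF exp_summable[of "\<bar>t\<bar> * (2 * N)"], of 0])
    fix n
    have "norm (T \<eta> n) \<le> \<bar>t\<bar> ^ n / fact n * ((2 * N) ^ n * M)"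
      unfolding T_def real_norm_def abs_mult
      using generator_funpow_abs_le[OF M that, where \<tau> = \<tau> and n = n]
      by (intro mult_mono) (auto simp: power_abs)
    then show "norm (T \<eta> n) \<le> M * (inverse (fact n) * (\<bar>t\<bar> * (2 * N)) ^ n)"
      by (simp add: power_mult_distrib field_simps)
  qed
  then have sums: "(\<lambda>n. \<Sum>\<eta>\<in>configs G. T \<eta> n * pmf \<mu> \<eta>) sums
      (\<Sum>\<eta>\<in>configs G. suminf (T \<eta>) * pmf \<mu> \<eta>)"
    by (intro sums_sum sums_mult2 summable_sums) auto
  have "(\<Sum>\<eta>\<in>configs G. T \<eta> n * pmf \<mu> \<eta>) = b n * t ^ n" for n
    unfolding b_def T_def expectation_eq_sum[OF \<mu>]
    by (simp add: sum_distrib_left sum_distrib_right sum_divide_distrib field_simps)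
  then show "measure_pmf.expectation \<mu> (noisy_voter_semigroup \<delta> G \<tau> t f) = (\<Sum>n. b n * t ^ n)"
    using sums
    by (simp add: expectation_eq_sum[OF \<mu>] noisy_voter_semigroup_def T_def sums_iff)
  show "summable b"
  proof (rule summable_comparison_test'[OF exp_summable[of "2 * N"], of 0])
    fix n
    have "\<bar>measure_pmf.expectation \<mu> ((noisy_voter_generator \<delta> G \<tau> ^^ n) f)\<bar> \<le> (2 * N) ^ n * M"
      using \<mu> M by (intro expectation_abs_le finite_set_pmf generator_funpow_abs_le) auto
    then show "norm (b n) \<le> M * (inverse (fact n) * (2 * N) ^ n)"
      by (simp add: b_def field_simps)
  qed
qed

text \<open>If the power series in \<open>t\<close> is constant, its linear coefficient vanishes,
  which is invariance. Conversely, if the generator has expectation 0 on every function, so do all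
  its positive powers, and only the term at \<open>n = 0\<close> survives.\<close>

lemma stationary_iff_invariant: "noisy_voter_stationary \<delta> G \<tau> \<mu> \<longleftrightarrow> invariant \<tau> \<mu>"
proof (cases "set_pmf \<mu> \<subseteq> configs G")
  case False
  then show ?thesis
    by (simp add: noisy_voter_stationary_def invariant_def)
next
  case \<mu>: True
  show ?thesis
  proof
    assume stat: "noisy_voter_stationary \<delta> G \<tau> \<mu>"
    have "measure_pmf.expectation \<mu> (noisy_voter_generator \<delta> G \<tau> f) = 0" for f
      using powser_const_imp_coeff_1_eq_0[OF expectation_semigroup(1)[OF \<mu>, of \<tau> f],
          of "measure_pmf.expectation \<mu> f"] stat
      unfolding expectation_semigroup(2)[OF \<mu>, symmetric]
      by (simp add: noisy_voter_stationary_def)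
    then show "invariant \<tau> \<mu>"
      by (simp add: invariant_iff_generator[OF \<mu>])
  next
    assume "invariant \<tau> \<mu>"
    then have inv: "measure_pmf.expectation \<mu> (noisy_voter_generator \<delta> G \<tau> f) = 0" for f
      by (simp add: invariant_iff_generator[OF \<mu>])
    have "measure_pmf.expectation \<mu> (noisy_voter_semigroup \<delta> G \<tau> t f) =
        measure_pmf.expectation \<mu> f" for t f
    proof -
      have "measure_pmf.expectation \<mu> ((noisy_voter_generator \<delta> G \<tau> ^^ n) f) = 0" if "n \<noteq> 0" for n
        using that inv by (cases n) auto
      then show ?thesis
        unfolding expectation_semigroup(2)[OF \<mu>] by (subst suminf_finite[of "{0}"]) auto
    qed
    then show "noisy_voter_stationary \<delta> G \<tau> \<mu>"
      using \<mu> by (simp add: noisy_voter_stationary_def)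
  qed
qed

section \<open>Existence and uniqueness of the stationary measure\<close>

text \<open>Each increment is the generator applied to an iterate, divided by \<open>N\<close>. It
  is bounded by the total influence of that iterate, which decays like \<open>q ^ n\<close>.\<close>

lemma step_funpow_convergent:
  assumes \<eta>: "\<eta> \<in> configs G"
  shows "convergent (\<lambda>n. (step \<tau> ^^ n) f \<eta>)"
proof -
  obtain a where a: "influence_le f a"
    using ex_influence_le by blast
  define X where "X = (\<lambda>n. (step \<tau> ^^ n) f \<eta>)"
  have "summable (\<lambda>n. X (Suc n) - X n)"
  proof (rule summable_comparison_test'[of "\<lambda>n. q ^ n * (\<Sum>x\<in>G. a x)" 0])
    show "summable (\<lambda>n. q ^ n * (\<Sum>x\<in>G. a x))"
      using q_nonneg q_less_1 by (intro summable_mult2 summable_geometric) auto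
    fix n
    have "\<bar>noisy_voter_generator \<delta> G \<tau> ((step \<tau> ^^ n) f) \<eta>\<bar> \<le> q ^ n * (\<Sum>x\<in>G. a x)"
      using generator_abs_le_sum_influence[OF influence_le_funpow[OF a] \<eta>] sum_funpow_spread[OF a]
      by (rule order_trans)
    moreover have "\<bar>noisy_voter_generator \<delta> G \<tau> ((step \<tau> ^^ n) f) \<eta>\<bar> / N
        \<le> \<bar>noisy_voter_generator \<delta> G \<tau> ((step \<tau> ^^ n) f) \<eta>\<bar> / 1"
      using N_ge_1 by (intro divide_left_mono) auto
    ultimately show "norm (X (Suc n) - X n) \<le> q ^ n * (\<Sum>x\<in>G. a x)"
      by (simp add: X_def step_def)
  qed
  then have "convergent (\<lambda>n. \<Sum>k<n. X (Suc k) - X k)"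
    by (simp add: summable_iff_convergent)
  then have "convergent (\<lambda>n. (X n - X 0) + X 0)"
    unfolding sum_lessThan_telescope by (intro convergent_add convergent_const)
  then show ?thesis
    by (simp add: X_def)
qed

text \<open>The transition probabilities from a fixed starting point \<eta> converge, and their
  limits \<open>m\<close> form an invariant probability vector.\<close>

lemma ex_invariant: "\<exists>\<mu>. invariant \<tau> \<mu>"
proof -
  have fin: "finite (configs G)"
    using finite_G by (rule finite_configs)
  obtain \<eta> where \<eta>: "\<eta> \<in> configs G"
    using configs_nonempty by blast
  define c where "c = (\<lambda>n \<zeta>. (step \<tau> ^^ n) (\<lambda>\<eta>. of_bool (\<eta> = \<zeta>)) \<eta>)"
  define m where "m = (\<lambda>\<zeta>. if \<zeta> \<in> configs G then lim (\<lambda>n. c n \<zeta>) else 0)"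
  have m: "(\<lambda>n. c n \<zeta>) \<longlonglongrightarrow> m \<zeta>" if "\<zeta> \<in> configs G" for \<zeta>
    using step_funpow_convergent[OF \<eta>] that by (simp add: m_def c_def convergent_LIMSEQ_iff)
  have lim: "(\<lambda>n. (step \<tau> ^^ n) f \<eta>) \<longlonglongrightarrow> (\<Sum>\<zeta>\<in>configs G. f \<zeta> * m \<zeta>)" for f
    unfolding step_funpow_eq_sum[OF \<eta>, where f = f] c_def[symmetric]
    using m by (intro tendsto_sum tendsto_mult tendsto_const) (auto simp: c_def)
  have nonneg: "m \<zeta> \<ge> 0" for \<zeta>
  proof (cases "\<zeta> \<in> configs G")
    case True
    have "c n \<zeta> \<ge> 0" for n
      unfolding c_def using \<eta> by (intro step_funpow_nonneg) auto
    then show ?thesis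
      using LIMSEQ_le_const[OF m[OF True]] by blast
  qed (simp add: m_def)
  have sum1: "(\<Sum>\<zeta>\<in>configs G. m \<zeta>) = 1"
    using lim[of "\<lambda>_. 1"] by (simp add: step_funpow_const LIMSEQ_const_iff)
  have "(\<integral>\<^sup>+\<zeta>. ennreal (m \<zeta>) \<partial>count_space UNIV) = (\<Sum>\<zeta>\<in>configs G. ennreal (m \<zeta>))"
    using fin by (intro nn_integral_count_space') (auto simp: m_def)
  also have "\<dots> = 1"
    using nonneg sum1 by (simp add: sum_ennreal)
  finally have pmf: "pmf (embed_pmf m) \<zeta> = m \<zeta>" for \<zeta>
    using nonneg by (intro pmf_embed_pmf)
  then have supp: "set_pmf (embed_pmf m) \<subseteq> configs G"
    by (auto simp: set_pmf_iff m_def split: if_splits)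
  have "measure_pmf.expectation (embed_pmf m) (step \<tau> f) = measure_pmf.expectation (embed_pmf m) f" for f
  proof -
    \<comment> \<open>The shifted sequence is read in two ways: as the iterates of
      \<open>step \<tau> f\<close>, and as a tail of the iterates of \<open>f\<close>.\<close>
    have "(\<lambda>n. (step \<tau> ^^ Suc n) f \<eta>) \<longlonglongrightarrow> (\<Sum>\<zeta>\<in>configs G. step \<tau> f \<zeta> * m \<zeta>)"
      using lim[of "step \<tau> f"] by (simp only: funpow_Suc_right o_def)
    moreover have "(\<lambda>n. (step \<tau> ^^ Suc n) f \<eta>) \<longlonglongrightarrow> (\<Sum>\<zeta>\<in>configs G. f \<zeta> * m \<zeta>)"
      using lim[of f] by (rule LIMSEQ_Suc)
    ultimately show ?thesis
      unfolding expectation_eq_sum[OF supp] pmf by (rule LIMSEQ_unique)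
  qed
  then show ?thesis
    using supp unfolding invariant_def by blast
qed

lemma expectation_step_funpow:
  "invariant \<tau> \<mu> \<Longrightarrow>
    measure_pmf.expectation \<mu> ((step \<tau> ^^ n) f) = measure_pmf.expectation \<mu> f"
  by (induction n) (auto simp: invariant_def)

text \<open>\<open>defect\<close> measures how far \<nu> is from being invariant. Iterating
  \<open>n\<close> times moves the expectation under \<nu> by at most a geometric sum, bounded by
  \<open>D / (1 - q) = D * N / \<kappa>\<close>, while the oscillation of the iterate tends to 0, so
  that \<mu> and \<nu> agree on it in the limit.\<close>

lemma expectation_diff_le:
  assumes \<mu>: "invariant \<tau> \<mu>" and \<nu>: "set_pmf \<nu> \<subseteq> configs G" and a: "influence_le f a"
    and D: "D \<ge> 0"
    and defect: "\<And>n. \<bar>measure_pmf.expectation \<nu> ((step \<tau> ^^ Suc n) f)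
        - measure_pmf.expectation \<nu> ((step \<tau> ^^ n) f)\<bar> \<le> D * q ^ n"
  shows "\<bar>measure_pmf.expectation \<mu> f - measure_pmf.expectation \<nu> f\<bar> \<le> D * N / \<kappa>"
proof -
  define g where "g = (\<lambda>n. (step \<tau> ^^ n) f)"
  have \<mu>_supp: "set_pmf \<mu> \<subseteq> configs G"
    using \<mu> by (simp add: invariant_def)
  have drift: "\<bar>measure_pmf.expectation \<nu> (g n) - measure_pmf.expectation \<nu> f\<bar> \<le> D * (\<Sum>k<n. q ^ k)" for n
  proof (induction n)
    case 0
    then show ?case by (simp add: g_def)
  next
    case (Suc n)
    then show ?case
      using defect[of n] by (simp add: g_def distrib_left)
  qed
  have geometric: "(\<Sum>k<n. q ^ k) \<le> N / \<kappa>" for n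
  proof -
    have "(\<Sum>k<n. q ^ k) \<le> (\<Sum>k. q ^ k)"
      using q_nonneg q_less_1 by (intro sum_le_suminf summable_geometric) auto
    also have "\<dots> = N / \<kappa>"
      using q_nonneg q_less_1 by (subst suminf_geometric) (auto simp: q_def)
    finally show ?thesis .
  qed
  have "\<bar>measure_pmf.expectation \<mu> f - measure_pmf.expectation \<nu> f\<bar>
      \<le> q ^ n * (\<Sum>x\<in>G. a x) + D * (N / \<kappa>)" for n
  proof -
    have "\<bar>measure_pmf.expectation \<mu> (g n) - measure_pmf.expectation \<nu> (g n)\<bar> \<le> (\<Sum>x\<in>G. (spread ^^ n) a x)"
      using \<mu>_supp \<nu> unfolding g_def
      by (intro expectation_diff_le_oscillation finite_set_pmf
            oscillation_le[OF influence_le_funpow[OF a]]) auto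
    moreover have "measure_pmf.expectation \<mu> (g n) = measure_pmf.expectation \<mu> f"
      unfolding g_def by (rule expectation_step_funpow[OF \<mu>])
    moreover have "D * (\<Sum>k<n. q ^ k) \<le> D * (N / \<kappa>)"
      using D geometric by (intro mult_left_mono)
    ultimately show ?thesis
      using drift[of n] sum_funpow_spread[OF a, of n] by linarith
  qed
  moreover have "(\<lambda>n. q ^ n * (\<Sum>x\<in>G. a x) + D * (N / \<kappa>)) \<longlonglongrightarrow> 0 * (\<Sum>x\<in>G. a x) + D * (N / \<kappa>)"
    using q_nonneg q_less_1 by (intro tendsto_intros LIMSEQ_power_zero) auto
  ultimately have "\<bar>measure_pmf.expectation \<mu> f - measure_pmf.expectation \<nu> f\<bar>
      \<le> 0 * (\<Sum>x\<in>G. a x) + D * (N / \<kappa>)"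
    by (intro LIMSEQ_le_const) auto
  then show ?thesis
    by simp
qed

text \<open>An invariant \<nu> has defect 0, so the comparison applies with
  \<open>D = 0\<close>.\<close>

lemma invariant_unique:
  assumes \<mu>: "invariant \<tau> \<mu>" and \<nu>: "invariant \<tau> \<nu>"
  shows "\<mu> = \<nu>"
proof (rule pmf_eqI)
  fix \<zeta>
  define f :: "(int ^ 'd \<Rightarrow> bool) \<Rightarrow> real" where "f = indicator {\<zeta>}"
  obtain a where a: "influence_le f a"
    using ex_influence_le by blast
  have "\<bar>measure_pmf.expectation \<mu> f - measure_pmf.expectation \<nu> f\<bar> \<le> 0 * N / \<kappa>"
    using \<nu> by (intro expectation_diff_le[OF \<mu> _ a])
      (auto simp: expectation_step_funpow[OF \<nu>] invariant_def simp del: funpow.simps)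
  then show "pmf \<mu> \<zeta> = pmf \<nu> \<zeta>"
    by (simp add: f_def pmf.rep_eq)
qed

lemma invariant_noisy_voter_measure: "invariant \<tau> (noisy_voter_measure \<delta> G \<tau>)"
proof -
  have "\<exists>!\<mu>. noisy_voter_stationary \<delta> G \<tau> \<mu>"
    using ex_invariant invariant_unique unfolding stationary_iff_invariant by blast
  then have "noisy_voter_stationary \<delta> G \<tau> (noisy_voter_measure \<delta> G \<tau>)"
    unfolding noisy_voter_measure_def by (rule theI')
  then show ?thesis
    by (simp add: stationary_iff_invariant)
qed

section \<open>Effect of one boundary spin\<close>

text \<open>One move distinguishes the boundary conditions only if the refreshed site
  \<open>x\<close> copies \<open>u\<close>, and then the value of \<open>f\<close> differs by at
  most \<open>a x\<close>.\<close>

lemma step_boundary_diff: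
  assumes eq: "\<And>v. v \<in> box_boundary G \<Longrightarrow> v \<noteq> u \<Longrightarrow> \<tau> v = \<tau>' v"
    and a: "influence_le f a" and \<eta>: "\<eta> \<in> configs G"
  shows "\<bar>step \<tau> f \<eta> - step \<tau>' f \<eta>\<bar> \<le> \<alpha> / N * (\<Sum>x\<in>G. of_bool (lattice_adj x u) * a x)"
proof -
  have site: "\<bar>site_update \<tau> x f \<eta> - site_update \<tau>' x f \<eta>\<bar> \<le> \<alpha> * (of_bool (lattice_adj x u) * a x)"
    if x: "x \<in> G" for x
  proof -
    have nb: "\<bar>f (\<eta>(x := with_boundary G \<tau> \<eta> y)) - f (\<eta>(x := with_boundary G \<tau>' \<eta> y))\<bar>
        \<le> of_bool (y = u) * a x" if "lattice_adj x y" for y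
    proof (cases "y = u")
      case True
      then show ?thesis
        using influence_le_upd[OF a \<eta> x] by simp
    next
      case False
      then have "with_boundary G \<tau> \<eta> y = with_boundary G \<tau>' \<eta> y"
        using eq[of y] that x by (auto simp: with_boundary_def box_boundary_def)
      then show ?thesis
        using False by simp
    qed
    have "\<bar>site_update \<tau> x f \<eta> - site_update \<tau>' x f \<eta>\<bar> = \<alpha> * \<bar>\<Sum>y | lattice_adj x y.
        f (\<eta>(x := with_boundary G \<tau> \<eta> y)) - f (\<eta>(x := with_boundary G \<tau>' \<eta> y))\<bar>"
      using \<alpha>_pos
      by (simp add: site_update_def sum_subtractf right_diff_distrib[symmetric] abs_mult)
    also have "\<dots> \<le> \<alpha> * (\<Sum>y | lattice_adj x y. of_bool (y = u) * a x)"
      using \<alpha>_pos nb by (intro mult_left_mono order_trans[OF sum_abs] sum_mono) auto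
    also have "(\<Sum>y | lattice_adj x y. of_bool (y = u) * a x) = of_bool (lattice_adj x u) * a x"
      by (simp add: sum_distrib_right[symmetric] of_bool_def sum.delta)
    finally show ?thesis .
  qed
  have "\<bar>step \<tau> f \<eta> - step \<tau>' f \<eta>\<bar> = \<bar>\<Sum>x\<in>G. site_update \<tau> x f \<eta> - site_update \<tau>' x f \<eta>\<bar> / N"
    by (simp add: step_eq sum_subtractf diff_divide_distrib[symmetric])
  also have "\<dots> \<le> (\<Sum>x\<in>G. \<alpha> * (of_bool (lattice_adj x u) * a x)) / N"
    by (intro divide_right_mono order_trans[OF sum_abs] sum_mono site) auto
  finally show ?thesis
    by (simp only: sum_distrib_left[symmetric] times_divide_eq_left)
qed

text \<open>A power of \<open>1 + \<delta>\<close>, the largest base that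
  \<open>slowly_varying\<close> admits, written with \<open>exp\<close> to match the final
  estimate.\<close>

definition decay :: "int ^ 'd \<Rightarrow> int ^ 'd \<Rightarrow> real" where
  "decay u x = exp (- ln (1 + \<delta>) * real_of_int (lattice_dist u x))"

lemma slowly_varying_decay: "slowly_varying (decay u)"
  unfolding slowly_varying_def
proof (intro conjI allI impI)
  fix x y :: "int ^ 'd" assume "lattice_adj x y"
  then have "lattice_dist u x \<le> lattice_dist u y + 1"
    using lattice_dist_triangle[of u x y] by (simp add: lattice_adj_def lattice_dist_commute)
  then have "ln (1 + \<delta>) * real_of_int (lattice_dist u x)
      \<le> ln (1 + \<delta>) * (real_of_int (lattice_dist u y) + 1)"
    using \<delta>_pos by (intro mult_left_mono) auto
  then have "decay u y \<le> exp (ln (1 + \<delta>) + - ln (1 + \<delta>) * real_of_int (lattice_dist u x))"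
    by (simp add: decay_def algebra_simps)
  then show "decay u y \<le> (1 + \<delta>) * decay u x"
    unfolding exp_add using \<delta>_pos by (simp add: decay_def)
qed (simp add: decay_def)

lemma decay_adj: "lattice_adj x u \<Longrightarrow> (1 + \<delta>) * decay u x = 1"
  using \<delta>_pos
  by (simp add: decay_def lattice_adj_def lattice_dist_commute[of u x] exp_minus field_simps)

text \<open>As \<nu> is invariant for \<open>\<tau>'\<close>, its defect under
  \<open>step \<tau>\<close> is the expectation of a difference of two kernels. This sees only the
  influence next to \<open>u\<close>, which the weights \<open>decay u\<close> dominate up to the
  factor \<open>1 + \<delta>\<close>.\<close>

lemma boundary_influence:
  assumes \<mu>: "invariant \<tau> \<mu>" and \<nu>: "invariant \<tau>' \<nu>"
    and eq: "\<And>v. v \<in> box_boundary G \<Longrightarrow> v \<noteq> u \<Longrightarrow> \<tau> v = \<tau>' v"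
    and a: "influence_le f a"
  shows "\<bar>measure_pmf.expectation \<mu> f - measure_pmf.expectation \<nu> f\<bar>
    \<le> \<alpha> * (1 + \<delta>) / \<kappa> * (\<Sum>x\<in>G. decay u x * a x)"
proof -
  define W where "W = (\<Sum>x\<in>G. decay u x * a x)"
  have supp: "set_pmf \<nu> \<subseteq> configs G"
    using \<nu> by (simp add: invariant_def)
  have int: "integrable \<nu> h" for h :: "(int ^ 'd \<Rightarrow> bool) \<Rightarrow> real"
    using finite_set_pmf[OF supp] by (rule integrable_measure_pmf_finite)
  have W: "W \<ge> 0"
    unfolding W_def using influence_le_nonneg[OF a] by (intro sum_nonneg) (simp add: decay_def)
  have "\<bar>measure_pmf.expectation \<nu> ((step \<tau> ^^ Suc n) f)
      - measure_pmf.expectation \<nu> ((step \<tau> ^^ n) f)\<bar> \<le> \<alpha> / N * (1 + \<delta>) * W * q ^ n" for n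
  proof -
    define g where "g = (step \<tau> ^^ n) f"
    have an: "influence_le g ((spread ^^ n) a)"
      unfolding g_def by (rule influence_le_funpow[OF a])
    have "(\<Sum>x\<in>G. of_bool (lattice_adj x u) * (spread ^^ n) a x)
        \<le> (\<Sum>x\<in>G. (1 + \<delta>) * decay u x * (spread ^^ n) a x)"
      using influence_le_nonneg[OF an] \<delta>_pos decay_adj
      by (intro sum_mono mult_right_mono) (auto simp: decay_def)
    also have "\<dots> = (1 + \<delta>) * (\<Sum>x\<in>G. decay u x * (spread ^^ n) a x)"
      by (simp add: sum_distrib_left mult.assoc)
    also have "\<dots> \<le> (1 + \<delta>) * (q ^ n * W)"
      unfolding W_def using \<delta>_pos
      by (intro mult_left_mono weighted_sum_funpow_spread[OF slowly_varying_decay a]) simp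
    finally have sum_le: "\<alpha> / N * (\<Sum>x\<in>G. of_bool (lattice_adj x u) * (spread ^^ n) a x)
        \<le> \<alpha> / N * ((1 + \<delta>) * (q ^ n * W))"
      using \<alpha>_pos by (intro mult_left_mono) auto
    have "\<bar>measure_pmf.expectation \<nu> (\<lambda>\<eta>. step \<tau> g \<eta> - step \<tau>' g \<eta>)\<bar>
        \<le> \<alpha> / N * ((1 + \<delta>) * (q ^ n * W))"
    proof (rule expectation_abs_le[OF finite_set_pmf[OF supp]])
      fix \<eta> assume "\<eta> \<in> set_pmf \<nu>"
      then show "\<bar>step \<tau> g \<eta> - step \<tau>' g \<eta>\<bar> \<le> \<alpha> / N * ((1 + \<delta>) * (q ^ n * W))"
        using step_boundary_diff[OF eq an] supp sum_le by (meson order_trans subsetD)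
    qed
    moreover have "measure_pmf.expectation \<nu> (step \<tau>' g) = measure_pmf.expectation \<nu> g"
      using \<nu> by (simp add: invariant_def)
    ultimately show ?thesis
      using int by (simp add: g_def mult_ac)
  qed
  \<comment> \<open>The \<open>1 / N\<close> from choosing a neighbour of \<open>u\<close> in one
    move cancels the \<open>N\<close> from the geometric series, so the bound does not depend on the
    size of \<open>G\<close>.\<close>
  then have "\<bar>measure_pmf.expectation \<mu> f - measure_pmf.expectation \<nu> f\<bar>
      \<le> \<alpha> / N * (1 + \<delta>) * W * N / \<kappa>"
    using W \<alpha>_pos \<delta>_pos by (intro expectation_diff_le[OF \<mu> supp a]) auto
  also have "\<dots> = \<alpha> * (1 + \<delta>) / \<kappa> * W"
    using N_ge_1 by simp
  finally show ?thesis
    by (simp add: W_def)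
qed

lemma tv_dist_marginal_le:
  assumes H: "H \<subseteq> G"
    and eq: "\<And>v. v \<in> box_boundary G \<Longrightarrow> v \<noteq> u \<Longrightarrow> \<tau> v = \<tau>' v"
  shows "tv_dist (configs H) (marginal H (noisy_voter_measure \<delta> G \<tau>))
      (marginal H (noisy_voter_measure \<delta> G \<tau>'))
    \<le> \<alpha> * (1 + \<delta>) / \<kappa> * (real (card H) * exp (- ln (1 + \<delta>) * real_of_int (box_dist u H)))"
    (is "_ \<le> ?K * ?B")
proof -
  have fin_H: "finite H"
    using H finite_G by (rule finite_subset)
  have decay_le: "decay u x \<le> exp (- ln (1 + \<delta>) * real_of_int (box_dist u H))" if "x \<in> H" for x
  proof -
    have "box_dist u H \<le> lattice_dist u x"
      unfolding box_dist_def using fin_H that by (intro Min_le) auto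
    then show ?thesis
      using \<delta>_pos by (simp add: decay_def mult_left_mono)
  qed
  have sum_le: "(\<Sum>x\<in>G. decay u x * of_bool (x \<in> H)) \<le> ?B"
  proof -
    have "(\<Sum>x\<in>G. decay u x * of_bool (x \<in> H)) = (\<Sum>x\<in>H. decay u x * of_bool (x \<in> H))"
      using H finite_G by (intro sum.mono_neutral_right) auto
    also have "\<dots> \<le> (\<Sum>x\<in>H. exp (- ln (1 + \<delta>) * real_of_int (box_dist u H)))"
      using decay_le by (intro sum_mono) auto
    finally show ?thesis
      by simp
  qed
  have event: "\<bar>measure_pmf.prob (marginal H (noisy_voter_measure \<delta> G \<tau>)) A
      - measure_pmf.prob (marginal H (noisy_voter_measure \<delta> G \<tau>')) A\<bar> \<le> ?K * ?B" for A
  proof -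
    define f :: "(int ^ 'd \<Rightarrow> bool) \<Rightarrow> real" where "f = indicator ((\<lambda>\<eta>. restrict \<eta> H) -` A)"
    \<comment> \<open>An event of the marginal does not see the spins outside \<open>H\<close>, and
      an indicator changes by at most 1.\<close>
    have "influence_le f (\<lambda>x. of_bool (x \<in> H))"
      unfolding influence_le_def
    proof (intro ballI)
      fix \<eta> x
      have "restrict (\<eta>(x := \<not> \<eta> x)) H = restrict \<eta> H" if "x \<notin> H"
        using that by (auto simp: restrict_def)
      then show "\<bar>f (\<eta>(x := \<not> \<eta> x)) - f \<eta>\<bar> \<le> of_bool (x \<in> H)"
        by (cases "x \<in> H") (auto simp: f_def indicator_def)
    qed
    then have "\<bar>measure_pmf.expectation (noisy_voter_measure \<delta> G \<tau>) f
        - measure_pmf.expectation (noisy_voter_measure \<delta> G \<tau>') f\<bar>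
        \<le> ?K * (\<Sum>x\<in>G. decay u x * of_bool (x \<in> H))"
      by (intro boundary_influence[OF invariant_noisy_voter_measure invariant_noisy_voter_measure eq])
    also have "\<dots> \<le> ?K * ?B"
      using \<alpha>_pos \<kappa>_pos \<delta>_pos by (intro mult_left_mono sum_le) auto
    finally show ?thesis
      by (simp add: f_def marginal_def)
  qed
  show ?thesis
    unfolding tv_dist_def using finite_configs[OF fin_H] event by (intro Max.boundedI) auto
qed

end

theorem corollary4p2:
  fixes \<delta> :: real
  assumes "\<delta> > 0"
  shows "\<exists>C>0. \<exists>c>0.
    \<forall>(G :: (int ^ 'd) set) H u \<tau> \<tau>'.
      finite G \<longrightarrow> H \<subseteq> G \<longrightarrow> H \<noteq> {} \<longrightarrow> u \<in> box_boundary G \<longrightarrow>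
      \<tau> \<in> configs (box_boundary G) \<longrightarrow> \<tau>' \<in> configs (box_boundary G) \<longrightarrow>
      (\<forall>v\<in>box_boundary G. \<tau> v \<noteq> \<tau>' v \<longleftrightarrow> v = u) \<longrightarrow>
      tv_dist (configs H)
        (marginal H (noisy_voter_measure \<delta> G \<tau>))
        (marginal H (noisy_voter_measure \<delta> G \<tau>'))
      \<le> C * real (card H) * exp (- c * real_of_int (box_dist u H))"
proof -
  \<comment> \<open>This is \<open>\<alpha> * (1 + \<delta>) / \<kappa>\<close> written out, since
    it has to be fixed before \<open>G\<close>; it equals
    \<open>(1 + \<delta>) / (2 * d * \<delta>)\<close> with d the dimension.\<close>
  define C where "C = 1 / ((2 * \<delta> + 1) * (2 * real CARD('d))) * (1 + \<delta>) / (\<delta> / (2 * \<delta> + 1))"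
  have bound: "tv_dist (configs H) (marginal H (noisy_voter_measure \<delta> G \<tau>))
      (marginal H (noisy_voter_measure \<delta> G \<tau>'))
      \<le> C * real (card H) * exp (- ln (1 + \<delta>) * real_of_int (box_dist u H))"
    if "finite G" "H \<subseteq> G" "H \<noteq> {}" and "\<forall>v\<in>box_boundary G. \<tau> v \<noteq> \<tau>' v \<longleftrightarrow> v = u"
    for G :: "(int ^ 'd) set" and H u \<tau> \<tau>'
  proof -
    interpret noisy_voter \<delta> G
      using assms that by unfold_locales auto
    have "C = \<alpha> * (1 + \<delta>) / \<kappa>"
      by (simp only: C_def \<alpha>_def \<kappa>_def)
    then show ?thesis
      using tv_dist_marginal_le[of H u \<tau> \<tau>'] that by (simp only: mult.assoc) blast
  qed
  have "C > 0"
    using assms by (simp add: C_def)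
  moreover have "ln (1 + \<delta>) > 0"
    using assms by simp
  ultimately show ?thesis
    using bound by (intro exI[of _ C] exI[of _ "ln (1 + \<delta>)"] conjI allI impI) auto
qed

end
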